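(* Let $p>2$ be a prime and $n\geq 1$. The fan $H_{p,pn-1}$ (in characteristic $p$) has: (1) $\binom{p}{3}n^3$ facets of type I; (2) $pn^2\binom{n}{2}\binom{p-1}{2}$ facets of type II; (3) $\binom{p}{2}\binom{n}{2}^2$ facets of type III. Consequently, for fixed $p$ the number of facets of $H_{p,m}$ is $\mathcal{O}(m^4)$.
   Context: $\mathbb{K}$ is an algebraically closed field with a nontrivial valuation $v:\mathbb{K}^*\to\mathbb{T}$, $\mathbb{Q}\subseteq\mathbb{T}\subseteq\mathbb{R}$; characteristic $p$ means both $\mathbb{K}$ and its residue field have characteristic $p$. Tropical polynomials of degree $m$, $f=\bigoplus_{r=0}^ma_rx^r$, are identified with $(a_0,\ldots,a_m)\in\mathbb{R}^{m+1}$. $H_{p,m}\subseteq\mathbb{R}^{m+1}$ is the (closure of the) set of $f$ having $0$ as tropical double root in characteristic $p$ (there are $F=\sum A_rX^r\in\mathbb{K}[X]$ with $v(A_r)=a_r$ and $B\in\mathbb{K}^*$, $v(B)=0$, a multiple root of $F$); it is a polyhedral fan of codimension 2, whose facets (maximal cells) are: type I $\{i,j,k\}$: minimum of the $a_r$ attained at $i,j,k$ with pairwise distinct residues mod $p$; type II $[\{i,j\},\{k,l\}]$: minimum attained at $i\neq j$ with $i\equiv j$, and after deleting all monomials $r\equiv i \pmod p$ the minimum is attained at $k,l$ with $k\not\equiv l$; type III $\{\{i,j\},\{k,l\}\}$: same as type II but with $k\equiv l$; the type III cells $\{\{i,j\},\{k,l\}\}$ and $\{\{k,l\},\{i,j\}\}$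 are the same facet. *)

theory Defs
  imports
    "HOL-Analysis.Analysis"
    "HOL-Number_Theory.Cong"
    "HOL-Computational_Algebra.Computational_Algebra"
    "HOL-Library.Landau_Symbols"
begin

text \<open>A valuation \<open>v : K\<^sup>* \<rightarrow> T\<close> with \<open>T \<subseteq> \<real>\<close>; the value \<open>v 0\<close> carries no meaning.\<close>

definition valuation_on :: "('k::field \<Rightarrow> real) \<Rightarrow> real set \<Rightarrow> bool" where
  "valuation_on v T \<longleftrightarrow>
     (\<forall>x. x \<noteq> 0 \<longrightarrow> v x \<in> T) \<and>
     (\<forall>x y. x \<noteq> 0 \<longrightarrow> y \<noteq> 0 \<longrightarrow> v (x * y) = v x + v y) \<and>
     (\<forall>x y. x \<noteq> 0 \<longrightarrow> y \<noteq> 0 \<longrightarrow> x + y \<noteq> 0 \<longrightarrow> min (v x) (v y) \<le> v (x + y))"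

definition nontrivial_valuation :: "('k::field \<Rightarrow> real) \<Rightarrow> bool" where
  "nontrivial_valuation v \<longleftrightarrow> (\<exists>x. x \<noteq> 0 \<and> v x \<noteq> 0)"

definition maximal_ideal :: "('k::field \<Rightarrow> real) \<Rightarrow> 'k set" where
  "maximal_ideal v = {x. x = 0 \<or> 0 < v x}"

text \<open>The characteristic of the residue field, i.e. of the valuation ring modulo its maximal
  ideal: the generator of the kernel of the map from the integers, as for \<open>CHAR\<close>.\<close>

definition residue_char :: "('k::field \<Rightarrow> real) \<Rightarrow> nat" where
  "residue_char v = Gcd {n. of_nat n \<in> maximal_ideal v}"

text \<open>\<open>\<real>\<^bsup>m+1\<^esup>\<close> is \<open>extensional {..m} :: (nat \<Rightarrow> real) set\<close>, so that \<open>m\<close> may vary. It is closed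
  in the product topology of \<open>nat \<Rightarrow> real\<close>, and the subspace topology is the Euclidean one, so
  \<open>closure\<close> below is the closure in \<open>\<real>\<^bsup>m+1\<^esup>\<close>.\<close>

definition zero_double_root :: "('k::field \<Rightarrow> real) \<Rightarrow> nat \<Rightarrow> (nat \<Rightarrow> real) \<Rightarrow> bool" where
  "zero_double_root v m a \<longleftrightarrow>
     (\<exists>F B. degree F = m \<and> (\<forall>r\<le>m. coeff F r \<noteq> 0 \<and> v (coeff F r) = a r) \<and>
            B \<noteq> 0 \<and> v B = 0 \<and> 2 \<le> order B F)"

definition double_root_fan :: "('k::field \<Rightarrow> real) \<Rightarrow> nat \<Rightarrow> (nat \<Rightarrow> real) set" where
  "double_root_fan v m = closure {a \<in> extensional {..m}. zero_double_root v m a}"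

definition min_attained_at :: "(nat \<Rightarrow> real) \<Rightarrow> nat set \<Rightarrow> nat set \<Rightarrow> bool" where
  "min_attained_at a R S \<longleftrightarrow> S \<subseteq> R \<and> (\<forall>s\<in>S. \<forall>r\<in>R. a s \<le> a r)"

definition remaining :: "nat \<Rightarrow> nat \<Rightarrow> nat \<Rightarrow> nat set" where
  "remaining p m i = {r \<in> {..m}. \<not> [r = i] (mod p)}"

definition cell_I :: "('k::field \<Rightarrow> real) \<Rightarrow> nat \<Rightarrow> nat \<Rightarrow> nat \<Rightarrow> nat \<Rightarrow> (nat \<Rightarrow> real) set" where
  "cell_I v m i j k = {a \<in> double_root_fan v m. min_attained_at a {..m} {i, j, k}}"

definition cell_II ::
    "('k::field \<Rightarrow> real) \<Rightarrow> nat \<Rightarrow> nat \<Rightarrow> nat \<Rightarrow> nat \<Rightarrow> nat \<Rightarrow> nat \<Rightarrow> (nat \<Rightarrow> real) set" where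
  "cell_II v p m i j k l =
     {a \<in> double_root_fan v m. min_attained_at a {..m} {i, j} \<and> min_attained_at a (remaining p m i) {k, l}}"

text \<open>For \<open>k \<equiv> l\<close> the condition defining \<open>cell_II\<close> describes the part \<open>a i \<le> a k\<close> of the cell
  \<open>{{i,j},{k,l}}\<close> and the one with the two pairs swapped the part \<open>a k \<le> a i\<close>. Their union
  is a single convex cone, the cell itself.\<close>

definition cell_III ::
    "('k::field \<Rightarrow> real) \<Rightarrow> nat \<Rightarrow> nat \<Rightarrow> nat \<Rightarrow> nat \<Rightarrow> nat \<Rightarrow> nat \<Rightarrow> (nat \<Rightarrow> real) set" where
  "cell_III v p m i j k l = cell_II v p m i j k l \<union> cell_II v p m k l i j"

definition type_I :: "('k::field \<Rightarrow> real) \<Rightarrow> nat \<Rightarrow> nat \<Rightarrow> (nat \<Rightarrow> real) set set" where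
  "type_I v p m = {cell_I v m i j k | i j k. {i, j, k} \<subseteq> {..m} \<and>
     \<not> [i = j] (mod p) \<and> \<not> [i = k] (mod p) \<and> \<not> [j = k] (mod p)}"

definition type_II :: "('k::field \<Rightarrow> real) \<Rightarrow> nat \<Rightarrow> nat \<Rightarrow> (nat \<Rightarrow> real) set set" where
  "type_II v p m = {cell_II v p m i j k l | i j k l. {i, j} \<subseteq> {..m} \<and> {k, l} \<subseteq> remaining p m i \<and>
     i \<noteq> j \<and> [i = j] (mod p) \<and> \<not> [k = l] (mod p)}"

definition type_III :: "('k::field \<Rightarrow> real) \<Rightarrow> nat \<Rightarrow> nat \<Rightarrow> (nat \<Rightarrow> real) set set" where
  "type_III v p m = {cell_III v p m i j k l | i j k l. {i, j} \<subseteq> {..m} \<and> {k, l} \<subseteq> remaining p m i \<and>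
     i \<noteq> j \<and> [i = j] (mod p) \<and> k \<noteq> l \<and> [k = l] (mod p)}"

text \<open>All other cells of the fan are proper faces of cells of the three types, so maximality has
  to be tested only against the latter.\<close>

definition facets :: "('k::field \<Rightarrow> real) \<Rightarrow> nat \<Rightarrow> nat \<Rightarrow> (nat \<Rightarrow> real) set set" where
  "facets v p m =
     {C \<in> type_I v p m \<union> type_II v p m \<union> type_III v p m.
        \<forall>D \<in> type_I v p m \<union> type_II v p m \<union> type_III v p m. C \<subseteq> D \<longrightarrow> C = D}"

end

theory Submission
  imports Defs
begin

text \<open>
  Every cell contains a point that lies in no other cell, so all cells are facets, the cells of each
  type are in bijection with their index sets, and it remains to count the latter.

  Such a point is tropicalised from a polynomial with double root \<open>1\<close>. This amounts to the two
  linear conditions \<open>\<Sum>A\<^sub>r = 0\<close> and \<open>\<Sum>r A\<^sub>r = 0\<close>. Fix \<open>t\<close> of positive valuation. For type I put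
  \<open>A\<^sub>k = 1\<close>, give every other coefficient the value \<open>t\<close>, and solve for \<open>A\<^sub>i\<close> and \<open>A\<^sub>j\<close>; the
  determinant \<open>j - i\<close> is a unit of the prime field, so both have valuation \<open>0\<close>. For types II and III
  put \<open>A\<^sub>i = 1\<close>, \<open>A\<^sub>k = t\<close> and give the other coefficients the value \<open>t\<^sup>2\<close>; since \<open>i = j\<close> in the
  field, the condition \<open>\<Sum>(r - i) A\<^sub>r = 0\<close> does not involve \<open>A\<^sub>j\<close> and determines \<open>A\<^sub>l\<close>, of the
  same valuation as \<open>t\<close>, and then the other condition yields \<open>A\<^sub>j\<close>, of valuation \<open>0\<close>.
\<close>

section \<open>Counting the index sets\<close>

text \<open>Cells do not depend on the order in which their exponents are listed, so they are
  indexed by sets. The parameter \<open>A\<close> restricts the admissible residues: all of them for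
  type I, all but the class of the first pair for the second pair of type II.\<close>

definition transversals :: "nat \<Rightarrow> nat set \<Rightarrow> nat set \<Rightarrow> nat \<Rightarrow> nat set set" where
  "transversals p X A q =
     {S. S \<subseteq> X \<and> card S = q \<and> inj_on (\<lambda>r. r mod p) S \<and> (\<lambda>r. r mod p) ` S \<subseteq> A}"

definition congruent_pairs :: "nat \<Rightarrow> nat set \<Rightarrow> nat \<Rightarrow> nat set set" where
  "congruent_pairs p X c = {S. S \<subseteq> X \<and> card S = 2 \<and> (\<forall>r\<in>S. r mod p = c)}"

definition indices_I :: "nat \<Rightarrow> nat set \<Rightarrow> nat set set" where
  "indices_I p X = transversals p X {..<p} 3"

definition indices_II :: "nat \<Rightarrow> nat set \<Rightarrow> (nat set \<times> nat set) set" where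
  "indices_II p X = (\<Union>c<p. congruent_pairs p X c \<times> transversals p X ({..<p} - {c}) 2)"

text \<open>A facet of type III has two ordered descriptions; \<open>c < d\<close> selects one of them.\<close>

definition indices_III :: "nat \<Rightarrow> nat set \<Rightarrow> (nat set \<times> nat set) set" where
  "indices_III p X = (\<Union>d<p. \<Union>c<d. congruent_pairs p X c \<times> congruent_pairs p X d)"

lemma indices_III_I:
  "S \<in> congruent_pairs p X c \<Longrightarrow> U \<in> congruent_pairs p X d \<Longrightarrow> c < d \<Longrightarrow> d < p \<Longrightarrow>
    (S, U) \<in> indices_III p X"
  by (auto simp: indices_III_def)

text \<open>Choose the \<open>q\<close> residues in \<open>A\<close>, then independently one of the
  \<open>n\<close> exponents in each chosen class. The exponents of residue \<open>c\<close> below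
  \<open>p * n\<close> are the numbers \<open>p * x + c\<close> with \<open>x < n\<close>.\<close>

lemma card_transversals:
  assumes "A \<subseteq> {..<p}"
  shows "card (transversals p {..<p * n} A q) = (card A choose q) * n ^ q"
proof -
  \<comment> \<open>\<open>h\<close> rebuilds a transversal from its set \<open>R\<close> of
    residues and the quotients \<open>f c\<close> of its elements by \<open>p\<close>. The functions
    in \<open>D\<close> are extensional, which makes this description unique.\<close>
  define D where "D = (SIGMA R:{R. R \<subseteq> A \<and> card R = q}. R \<rightarrow>\<^sub>E {..<n})"
  define h where "h = (\<lambda>(R :: nat set, f). (\<lambda>c. p * f c + c) ` R)"
  have fin: "finite A"
    using assms finite_subset by blast
  have lt: "c < p" if "R \<subseteq> A" "c \<in> R" for c R
    using assms that by auto
  have md: "(p * x + c) mod p = c" "(p * x + c) div p = x" if "R \<subseteq> A" "c \<in> R" for c R x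
    using lt[OF that] by auto
  have residues: "(\<lambda>r. r mod p) ` h (R, f) = R" if "R \<subseteq> A" for R f
    using md[OF that] by (force simp: h_def image_image)
  have inj: "inj_on h D"
  proof (rule inj_onI, clarify)
    fix R f R' f'
    assume mem: "(R, f) \<in> D" "(R', f') \<in> D" and eq: "h (R, f) = h (R', f')"
    from mem have sub: "R \<subseteq> A" "R' \<subseteq> A"
      by (auto simp: D_def)
    have R: "R' = R"
      using residues[OF sub(1), of f] residues[OF sub(2), of f'] eq by simp
    have "f c = f' c" if "c \<in> R" for c
    proof -
      have "p * f c + c \<in> h (R', f')"
        unfolding eq[symmetric] using that by (auto simp: h_def)
      then obtain d where d: "d \<in> R" "p * f c + c = p * f' d + d"
        by (auto simp: h_def R)
      have "c = d"
        using d md(1)[OF sub(1) that, of "f c"] md(1)[OF sub(1) d(1), of "f' d"] by simp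
      then show ?thesis
        using d lt[OF sub(1) that] by simp
    qed
    then have "f = f'"
      using mem R by (intro PiE_ext[of f R "\<lambda>_. {..<n}" f']) (auto simp: D_def)
    with R show "R = R' \<and> f = f'"
      by simp
  qed
  have img: "h ` D = transversals p {..<p * n} A q"
  proof (intro equalityI subsetI)
    fix S assume "S \<in> h ` D"
    then obtain R f where Rf: "R \<subseteq> A" "card R = q" "f \<in> R \<rightarrow>\<^sub>E {..<n}" and S: "S = h (R, f)"
      by (auto simp: D_def)
    have "inj_on (\<lambda>c. p * f c + c) R"
      by (rule inj_on_inverseI[of _ "\<lambda>r. r mod p"]) (use md Rf in auto)
    then have "card S = q"
      using Rf by (simp add: S h_def card_image)
    moreover have "inj_on (\<lambda>r. r mod p) S"
      using md[OF Rf(1)] by (auto simp: S h_def inj_on_def)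
    moreover have "p * f c + c < p * n" if "c \<in> R" for c
    proof -
      have "p * f c + c < p * Suc (f c)"
        using lt[OF Rf(1) that] by simp
      also have "\<dots> \<le> p * n"
        using Rf that by (intro mult_le_mono2) (auto simp: PiE_iff Suc_le_eq)
      finally show ?thesis .
    qed
    then have "S \<subseteq> {..<p * n}"
      by (auto simp: S h_def)
    ultimately show "S \<in> transversals p {..<p * n} A q"
      using residues[OF Rf(1)] Rf by (simp add: transversals_def S)
  next
    fix S assume "S \<in> transversals p {..<p * n} A q"
    then have S: "S \<subseteq> {..<p * n}" "card S = q" "inj_on (\<lambda>r. r mod p) S" "(\<lambda>r. r mod p) ` S \<subseteq> A"
      by (auto simp: transversals_def)
    \<comment> \<open>The inverse of \<open>h\<close>: the residues of \<open>S\<close>, and for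
      each of them the quotient of the only element of \<open>S\<close> with that residue.\<close>
    define R where "R = (\<lambda>r. r mod p) ` S"
    define f where "f = restrict (\<lambda>c. inv_into S (\<lambda>r. r mod p) c div p) R"
    have f: "f (r mod p) = r div p" if "r \<in> S" for r
      using that inv_into_f_f[OF S(3) that] by (simp add: f_def R_def)
    have "h (R, f) = (\<lambda>r. r) ` S"
      unfolding h_def R_def image_image prod.case by (intro image_cong) (simp_all add: f)
    moreover have "(R, f) \<in> D"
    proof -
      have "f c < n" if "c \<in> R" for c
        using that S(1) f by (auto simp: R_def less_mult_imp_div_less mult.commute)
      then show ?thesis
        using S by (auto simp: D_def R_def f_def card_image)
    qed
    ultimately show "S \<in> h ` D"
      by (metis image_eqI image_ident)
  qed
  have "card (R \<rightarrow>\<^sub>E {..<n}) = n ^ q" if "R \<subseteq> A" "card R = q" for R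
    using that fin by (simp add: card_PiE finite_subset)
  then have "card D = (card A choose q) * n ^ q"
    unfolding D_def using fin
    by (subst card_SigmaI) (auto simp: n_subsets intro!: finite_PiE intro: finite_subset)
  then show ?thesis
    using card_image[OF inj] img by simp
qed

lemma card_residue_class:
  assumes "c < p"
  shows "card {r. r < p * n \<and> r mod p = c} = n"
proof -
  have "bij_betw (\<lambda>x. p * x + c) {..<n} {r. r < p * n \<and> r mod p = c}"
  proof (rule bij_betw_byWitness[of _ "\<lambda>r. r div p"])
    show "(\<lambda>x. p * x + c) ` {..<n} \<subseteq> {r. r < p * n \<and> r mod p = c}"
    proof clarsimp
      fix x assume "x < n"
      then have "p * Suc x \<le> p * n"
        by (intro mult_le_mono2) simp
      then show "p * x + c < p * n \<and> c mod p = c"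
        using assms by simp
    qed
  qed (use assms in \<open>auto simp: less_mult_imp_div_less mult.commute\<close>)
  then show ?thesis
    using bij_betw_same_card by fastforce
qed

lemma card_congruent_pairs:
  assumes "c < p"
  shows "card (congruent_pairs p {..<p * n} c) = n choose 2"
proof -
  have "congruent_pairs p {..<p * n} c = {S. S \<subseteq> {r. r < p * n \<and> r mod p = c} \<and> card S = 2}"
    by (auto simp: congruent_pairs_def)
  then show ?thesis
    by (simp add: n_subsets card_residue_class[OF assms])
qed

lemma finite_congruent_pairs: "finite X \<Longrightarrow> finite (congruent_pairs p X c)"
  by (rule finite_subset[of _ "Pow X"]) (auto simp: congruent_pairs_def)

lemma finite_transversals: "finite X \<Longrightarrow> finite (transversals p X A q)"
  by (rule finite_subset[of _ "Pow X"]) (auto simp: transversals_def)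

lemma congruent_pairs_unique: "S \<in> congruent_pairs p X c \<Longrightarrow> S \<in> congruent_pairs p X d \<Longrightarrow> c = d"
  by (auto simp: congruent_pairs_def card_2_iff)

lemma card_indices_I: "card (indices_I p {..<p * n}) = (p choose 3) * n ^ 3"
  by (simp add: indices_I_def card_transversals)

text \<open>There are \<open>p\<close> choices for the class of the first pair, and
  \<open>p - 1\<close> classes are left for the second. The union over classes is disjoint because a
  nonempty set of congruent numbers determines its class.\<close>

lemma card_indices_II:
  "card (indices_II p {..<p * n}) = p * n ^ 2 * (n choose 2) * ((p - 1) choose 2)"
proof -
  have "card (indices_II p {..<p * n})
      = (\<Sum>c<p. card (congruent_pairs p {..<p * n} c \<times> transversals p {..<p * n} ({..<p} - {c}) 2))"
    unfolding indices_II_def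
    by (intro card_UN_disjoint)
      (auto simp: finite_congruent_pairs finite_transversals dest: congruent_pairs_unique)
  also have "\<dots> = (\<Sum>c<p. (n choose 2) * (((p - 1) choose 2) * n ^ 2))"
    by (intro sum.cong) (simp_all add: card_cartesian_product card_congruent_pairs card_transversals)
  finally show ?thesis
    by simp
qed

text \<open>For each larger class \<open>d\<close> there are \<open>d\<close> choices of the smaller
  one, and summing \<open>d\<close> over \<open>d < p\<close> gives the number of unordered pairs of
  classes.\<close>

lemma card_indices_III:
  "card (indices_III p {..<p * n}) = (p choose 2) * (n choose 2) ^ 2"
proof -
  let ?P = "congruent_pairs p {..<p * n}"
  have "card (indices_III p {..<p * n}) = (\<Sum>d<p. card (\<Union>c<d. ?P c \<times> ?P d))"
    unfolding indices_III_def
    by (intro card_UN_disjoint) (auto simp: finite_congruent_pairs dest: congruent_pairs_unique)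
  also have "\<dots> = (\<Sum>d<p. d * (n choose 2) ^ 2)"
  proof (rule sum.cong)
    fix d assume d: "d \<in> {..<p}"
    have "card (\<Union>c<d. ?P c \<times> ?P d) = (\<Sum>c<d. card (?P c \<times> ?P d))"
      by (intro card_UN_disjoint) (auto simp: finite_congruent_pairs dest: congruent_pairs_unique)
    also have "\<dots> = (\<Sum>c<d. (n choose 2) ^ 2)"
      using d by (intro sum.cong)
        (simp_all add: card_cartesian_product card_congruent_pairs power2_eq_square)
    finally show "card (\<Union>c<d. ?P c \<times> ?P d) = d * (n choose 2) ^ 2"
      by simp
  qed simp
  also have "\<dots> = (\<Sum>d<p. d) * (n choose 2) ^ 2"
    by (simp add: sum_distrib_right)
  also have "(\<Sum>d<p. d) = p choose 2"
    by (simp add: choose_two Sum_Ico_nat lessThan_atLeast0)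
  finally show ?thesis .
qed

section \<open>Polynomials with double root 1\<close>

locale valued_field_char =
  fixes v :: "'k::field \<Rightarrow> real" and T :: "real set" and p :: nat
  assumes valuation: "valuation_on v T"
    and nontrivial: "nontrivial_valuation v"
    and prime_p: "prime p"
    and char_p: "CHAR('k) = p"
begin

section \<open>The valuation ring and valuations of integers\<close>

lemma v_mult: "x \<noteq> 0 \<Longrightarrow> y \<noteq> 0 \<Longrightarrow> v (x * y) = v x + v y"
  using valuation by (auto simp: valuation_on_def)

lemma v_add_ge: "x \<noteq> 0 \<Longrightarrow> y \<noteq> 0 \<Longrightarrow> x + y \<noteq> 0 \<Longrightarrow> min (v x) (v y) \<le> v (x + y)"
  using valuation by (auto simp: valuation_on_def)

lemma v_one: "v 1 = 0"
  using v_mult[of 1 1] by simp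

lemma v_minus: "v (- x) = v x"
proof (cases "x = 0")
  case False
  have "v (- 1) = 0"
    using v_mult[of "- 1" "- 1"] v_one by simp
  then show ?thesis
    using v_mult[of "- 1" x] False by simp
qed simp

lemma v_divide: "x \<noteq> 0 \<Longrightarrow> y \<noteq> 0 \<Longrightarrow> v (x / y) = v x - v y"
  using v_mult[of "x / y" y] by simp

text \<open>Zero is listed separately because \<open>v 0\<close> is an arbitrary real
  number.\<close>

definition valuation_ring :: "'k set" where
  "valuation_ring = {x. x = 0 \<or> 0 \<le> v x}"

lemma valuation_ring_add: "x \<in> valuation_ring \<Longrightarrow> y \<in> valuation_ring \<Longrightarrow> x + y \<in> valuation_ring"
  unfolding valuation_ring_def using v_add_ge[of x y]
  by (cases "x = 0"; cases "y = 0"; cases "x + y = 0") (auto simp: min_le_iff_disj)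

lemma valuation_ring_mult: "x \<in> valuation_ring \<Longrightarrow> y \<in> valuation_ring \<Longrightarrow> x * y \<in> valuation_ring"
  unfolding valuation_ring_def using v_mult[of x y]
  by (cases "x = 0"; cases "y = 0") auto

lemma valuation_ring_minus: "x \<in> valuation_ring \<Longrightarrow> - x \<in> valuation_ring"
  by (auto simp: valuation_ring_def v_minus)

lemma valuation_ring_diff: "x \<in> valuation_ring \<Longrightarrow> y \<in> valuation_ring \<Longrightarrow> x - y \<in> valuation_ring"
  using valuation_ring_add[of x "- y"] valuation_ring_minus[of y] by simp

lemma valuation_ring_of_nat: "of_nat n \<in> valuation_ring"
proof (induction n)
  case (Suc n)
  have "1 \<in> valuation_ring"
    by (simp add: valuation_ring_def v_one)
  with Suc show ?case
    using valuation_ring_add[of 1 "of_nat n"] by simp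
qed (simp add: valuation_ring_def)

lemma valuation_ring_sum: "(\<And>x. x \<in> X \<Longrightarrow> f x \<in> valuation_ring) \<Longrightarrow> sum f X \<in> valuation_ring"
proof (induction X rule: infinite_finite_induct)
  case (insert x X)
  then show ?case
    by (simp add: valuation_ring_add)
qed (simp_all add: valuation_ring_def)

lemmas valuation_ring_closed = valuation_ring_add valuation_ring_mult valuation_ring_minus
  valuation_ring_diff valuation_ring_of_nat valuation_ring_sum

text \<open>The ultrametric inequality for \<open>u + t * x\<close> gives one bound; the other comes
  from writing \<open>u\<close> as the difference of \<open>u + t * x\<close> and
  \<open>t * x\<close>, the latter being of positive valuation. The lemma shows that the
  coefficients solved for below have the valuation of their leading term.\<close>

lemma unit_add_maximal_ideal:
  assumes "u \<noteq> 0" "v u = 0" "t \<noteq> 0" "0 < v t" "x \<in> valuation_ring"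
  shows "u + t * x \<noteq> 0 \<and> v (u + t * x) = 0"
proof (cases "x = 0")
  case False
  then have y: "t * x \<noteq> 0" "0 < v (t * x)"
    using assms by (auto simp: v_mult valuation_ring_def)
  have "u + t * x \<noteq> 0"
  proof
    assume "u + t * x = 0"
    then have "u = - (t * x)"
      by (simp add: eq_neg_iff_add_eq_0)
    then show False
      using y(2) assms(2) by (simp add: v_minus)
  qed
  moreover from this have "0 \<le> v (u + t * x)"
    using v_add_ge[of u "t * x"] y assms by simp
  moreover have "min (v (u + t * x)) (v (- (t * x))) \<le> v (u + t * x + - (t * x))"
    by (rule v_add_ge) (use y assms calculation in auto)
  then have "v (u + t * x) \<le> 0"
    using y assms by (auto simp: v_minus min_le_iff_disj)
  ultimately show ?thesis
    by simp
qed (use assms in simp)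

lemma of_nat_eq_iff: "(of_nat i :: 'k) = of_nat j \<longleftrightarrow> [i = j] (mod p)"
  by (simp add: of_nat_eq_iff_cong_CHAR char_p)

text \<open>An inverse of \<open>n\<close> modulo \<open>p\<close> is a natural number that inverts
  \<open>n\<close> in the field as well. Both factors have nonnegative valuation, and the two
  valuations add up to \<open>v 1 = 0\<close>.\<close>

lemma v_of_nat_eq_0:
  assumes "\<not> p dvd n"
  shows "v (of_nat n) = 0"
proof -
  have "coprime n p"
    using prime_imp_coprime[OF prime_p assms] by (simp add: coprime_commute)
  then obtain x where "[n * x = 1] (mod p)"
    using cong_solve_coprime_nat by auto
  then have "(of_nat (n * x) :: 'k) = of_nat 1"
    by (simp only: of_nat_eq_iff)
  then have *: "(of_nat n :: 'k) * of_nat x = 1"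
    by simp
  then have nz: "(of_nat n :: 'k) \<noteq> 0" "(of_nat x :: 'k) \<noteq> 0"
    by auto
  have "v (of_nat n) + v (of_nat x) = 0"
    using v_mult[OF nz] by (simp add: * v_one)
  moreover have "0 \<le> v (of_nat n)" "0 \<le> v (of_nat x)"
    using valuation_ring_of_nat[of n] valuation_ring_of_nat[of x] nz
    by (auto simp: valuation_ring_def)
  ultimately show ?thesis
    by simp
qed

lemma v_of_nat_diff:
  assumes "\<not> [i = j] (mod p)"
  shows "(of_nat i :: 'k) - of_nat j \<noteq> 0" "v (of_nat i - of_nat j) = 0"
proof -
  show "(of_nat i :: 'k) - of_nat j \<noteq> 0"
    using assms by (simp add: of_nat_eq_iff)
  have *: "v (of_nat a - of_nat b) = 0" if "b \<le> a" "\<not> [a = b] (mod p)" for a b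
    using that v_of_nat_eq_0[of "a - b"] by (simp add: cong_altdef_nat)
  show "v (of_nat i - of_nat j) = 0"
  proof (cases "j \<le> i")
    case True
    then show ?thesis
      using * assms by blast
  next
    case False
    then have "v (of_nat j - of_nat i) = 0"
      using * assms by (simp add: cong_sym_eq)
    then show ?thesis
      using v_minus[of "of_nat j - of_nat i"] by simp
  qed
qed

lemma ex_pos_valuation: "\<exists>t. t \<noteq> 0 \<and> 0 < v t"
proof -
  obtain x where x: "x \<noteq> 0" "v x \<noteq> 0"
    using nontrivial by (auto simp: nontrivial_valuation_def)
  then have "v (1 / x) = - v x"
    by (simp add: v_divide v_one del: divide_eq_1_iff)
  then show ?thesis
    using x by (cases "0 < v x") (auto intro: exI[of _ "1 / x"])
qed

section \<open>Points of the fan from explicit polynomials\<close>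

text \<open>The two sums are the values at \<open>1\<close> of the polynomial and of its derivative,
  so \<open>1\<close> is a root of order at least two; it is admissible as \<open>B\<close> since
  \<open>v 1 = 0\<close>.\<close>

lemma mem_double_root_fanI:
  fixes A :: "nat \<Rightarrow> 'k"
  assumes nz: "\<And>r. r \<le> m \<Longrightarrow> A r \<noteq> 0"
    and sum: "(\<Sum>r\<le>m. A r) = 0" and dsum: "(\<Sum>r\<le>m. of_nat r * A r) = 0"
  shows "restrict (\<lambda>r. v (A r)) {..m} \<in> double_root_fan v m"
proof -
  define F where "F = (\<Sum>r\<le>m. monom (A r) r)"
  have coeff: "coeff F r = (if r \<le> m then A r else 0)" for r
    by (simp add: F_def coeff_sum)
  have deg: "degree F = m"
    by (intro antisym degree_le le_degree) (auto simp: coeff nz)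
  have "F \<noteq> 0"
    using coeff[of 0] nz[of 0] by auto
  have "poly F 1 = 0"
    using sum by (simp add: F_def poly_sum poly_monom)
  then obtain G where G: "F = [:- 1, 1:] * G"
    by (auto simp: poly_eq_0_iff_dvd)
  have "poly (pderiv F) 1 = 0"
    using dsum by (simp add: F_def higher_pderiv_sum[of 1, simplified] poly_sum pderiv_monom poly_monom)
  \<comment> \<open>By the product rule for \<open>F = (X - 1) G\<close>, the derivative of
    \<open>F\<close> and the cofactor \<open>G\<close> agree at \<open>1\<close>, so
    \<open>G\<close> has the root \<open>1\<close> too.\<close>
  moreover have "poly (pderiv F) 1 = poly G 1"
    unfolding G pderiv_mult by (simp add: pderiv_pCons)
  ultimately obtain H where "G = [:- 1, 1:] * H"
    by (auto simp: poly_eq_0_iff_dvd)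
  then have "[:- 1, 1:] ^ 2 dvd F"
    unfolding G power2_eq_square by (metis dvd_triv_left mult.assoc)
  then have "2 \<le> order 1 F"
    using \<open>F \<noteq> 0\<close> order_divides[of 1 2 F] by simp
  then have "zero_double_root v m (restrict (\<lambda>r. v (A r)) {..m})"
    unfolding zero_double_root_def using deg coeff nz v_one
    by (intro exI[of _ F] exI[of _ 1]) auto
  then show ?thesis
    unfolding double_root_fan_def by (intro subsetD[OF closure_subset]) auto
qed

lemma generic_point_triple:
  assumes ijk: "i \<le> m" "j \<le> m" "k \<le> m"
    and cong: "\<not> [i = j] (mod p)" "\<not> [i = k] (mod p)" "\<not> [j = k] (mod p)"
  shows "\<exists>a \<in> double_root_fan v m. a i = 0 \<and> a j = 0 \<and> a k = 0 \<and>
           (\<forall>r\<le>m. r \<notin> {i, j, k} \<longrightarrow> 0 < a r)"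
proof -
  obtain t where t: "t \<noteq> 0" "0 < v t"
    using ex_pos_valuation by blast
  have ne: "i \<noteq> j" "i \<noteq> k" "j \<noteq> k"
    using cong by auto
  define R where "R = {..m} - {i, j, k}"
  \<comment> \<open>The coefficients with exponent in \<open>R\<close> all equal \<open>t\<close>,
    so they contribute \<open>t * N\<close> to the sum of the coefficients and \<open>t * M\<close>
    to the weighted sum.\<close>
  define N :: 'k where "N = of_nat (card R)"
  define M :: 'k where "M = (\<Sum>r\<in>R. of_nat r)"
  \<comment> \<open>Cramer's rule for \<open>Ai + Aj = - (1 + t * N)\<close> and
    \<open>i * Ai + j * Aj = - (k + t * M)\<close>, whose determinant is
    \<open>j - i\<close>.\<close>
  define Ai where "Ai = ((of_nat k - of_nat j) + t * (M - of_nat j * N)) / (of_nat j - of_nat i)"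
  define Aj where "Aj = ((of_nat i - of_nat k) + t * (of_nat i * N - M)) / (of_nat j - of_nat i)"
  define A where "A r = (if r = i then Ai else if r = j then Aj else if r = k then 1 else t)" for r
  have D: "(of_nat j :: 'k) - of_nat i \<noteq> 0" "v (of_nat j - of_nat i) = 0"
    using v_of_nat_diff[of j i] cong by (auto simp: cong_sym_eq)
  have integral: "M - of_nat j * N \<in> valuation_ring" "of_nat i * N - M \<in> valuation_ring"
    unfolding M_def N_def by (intro valuation_ring_closed)+
  have "(of_nat k :: 'k) - of_nat j \<noteq> 0" "v (of_nat k - of_nat j) = 0"
    using v_of_nat_diff[of k j] cong by (auto simp: cong_sym_eq)
  from unit_add_maximal_ideal[OF this t integral(1)] have Ai: "Ai \<noteq> 0" "v Ai = 0"
    using D by (simp_all add: Ai_def v_divide)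
  from unit_add_maximal_ideal[OF v_of_nat_diff[OF cong(2)] t integral(2)]
  have Aj: "Aj \<noteq> 0" "v Aj = 0"
    using D by (simp_all add: Aj_def v_divide)
  have split: "{..m} = insert i (insert j (insert k R))"
    using ijk by (auto simp: R_def)
  have R: "finite R" "i \<notin> R" "j \<notin> R" "k \<notin> R"
    by (auto simp: R_def)
  have AR: "A r = t" if "r \<in> R" for r
    using that by (auto simp: A_def R_def)
  have A: "A i = Ai" "A j = Aj" "A k = 1"
    using ne by (auto simp: A_def)
  have DAi: "(of_nat j - of_nat i) * Ai = (of_nat k - of_nat j) + t * (M - of_nat j * N)"
    using D by (simp add: Ai_def)
  have DAj: "(of_nat j - of_nat i) * Aj = (of_nat i - of_nat k) + t * (of_nat i * N - M)"
    using D by (simp add: Aj_def)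
  have sumR: "(\<Sum>r\<in>R. A r) = t * N" "(\<Sum>r\<in>R. of_nat r * A r) = t * M"
    by (simp_all add: AR N_def M_def sum_distrib_left mult.commute cong: sum.cong)
  have sum: "(\<Sum>r\<le>m. A r) = Ai + Aj + 1 + t * N"
    unfolding split using R ne by (simp add: A sumR)
  have dsum: "(\<Sum>r\<le>m. of_nat r * A r) = of_nat i * Ai + of_nat j * Aj + of_nat k + t * M"
    unfolding split using R ne by (simp add: A sumR)
  \<comment> \<open>Multiplying by the nonzero determinant removes the denominators of
    \<open>Ai\<close> and \<open>Aj\<close>.\<close>
  have "(of_nat j - of_nat i) * (Ai + Aj + 1 + t * N)
      = (of_nat j - of_nat i) * Ai + (of_nat j - of_nat i) * Aj + (of_nat j - of_nat i) * (1 + t * N)"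
    by (simp add: algebra_simps)
  also have "\<dots> = 0"
    unfolding DAi DAj by (simp add: algebra_simps)
  finally have "(of_nat j - of_nat i) * (Ai + Aj + 1 + t * N) = 0" .
  then have s0: "Ai + Aj + 1 + t * N = 0"
    using D by simp
  \<comment> \<open>Subtracting \<open>i\<close> times the first condition from the second one
    eliminates \<open>Ai\<close> and leaves the equation defining \<open>Aj\<close>.\<close>
  have "of_nat i * Ai + of_nat j * Aj + of_nat k + t * M
      = of_nat i * (Ai + Aj + 1 + t * N) + ((of_nat j - of_nat i) * Aj
        - ((of_nat i - of_nat k) + t * (of_nat i * N - M)))"
    by (simp add: algebra_simps)
  then have "of_nat i * Ai + of_nat j * Aj + of_nat k + t * M = 0"
    by (simp add: s0 DAj)
  then have "restrict (\<lambda>r. v (A r)) {..m} \<in> double_root_fan v m"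
    by (intro mem_double_root_fanI) (use s0 Ai Aj t in \<open>simp_all only: sum dsum, simp_all add: A_def\<close>)
  then show ?thesis
    using ijk Ai Aj t v_one A by (intro bexI) (auto simp: A_def)
qed

text \<open>The three levels of the point are \<open>0\<close>, \<open>g = v t\<close> and
  \<open>2 * g\<close>. The exponents \<open>k\<close> and \<open>l\<close> may be congruent or not,
  so the lemma serves types II and III alike.\<close>

lemma generic_point_pair:
  assumes ijkl: "i \<le> m" "j \<le> m" "k \<le> m" "l \<le> m" "i \<noteq> j" "k \<noteq> l"
    and cong: "[i = j] (mod p)" "\<not> [k = i] (mod p)" "\<not> [l = i] (mod p)"
  shows "\<exists>a \<in> double_root_fan v m. \<exists>g>0. a i = 0 \<and> a j = 0 \<and> a k = g \<and> a l = g \<and>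
           (\<forall>r\<le>m. r \<notin> {i, j, k, l} \<longrightarrow> g < a r)"
proof -
  obtain t where t: "t \<noteq> 0" "0 < v t"
    using ex_pos_valuation by blast
  have ne: "i \<noteq> k" "i \<noteq> l" "j \<noteq> k" "j \<noteq> l"
    using cong cong_sym by auto
  define R where "R = {..m} - {i, j, k, l}"
  define N :: 'k where "N = of_nat (card R)"
  define M :: 'k where "M = (\<Sum>r\<in>R. of_nat r)"
  \<comment> \<open>The coefficient at \<open>l\<close> is \<open>t * B\<close>. Dividing the sum of
    \<open>(r - i) * A r\<close> by \<open>t\<close> leaves
    \<open>(k - i) + (l - i) * B + t * (M - i * N)\<close>, and \<open>B\<close> makes this vanish;
    \<open>Aj\<close> is then forced by the sum of all coefficients.\<close>
  define B where "B = - (((of_nat k - of_nat i) + t * (M - of_nat i * N)) / (of_nat l - of_nat i))"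
  define Aj where "Aj = - (1 + t * (1 + B + t * N))"
  define A where "A r = (if r = i then 1 else if r = j then Aj else if r = k then t
    else if r = l then t * B else t * t)" for r
  note D = v_of_nat_diff[OF cong(3)]
  have integral: "M - of_nat i * N \<in> valuation_ring"
    unfolding M_def N_def by (intro valuation_ring_closed)
  from unit_add_maximal_ideal[OF v_of_nat_diff[OF cong(2)] t this] have B: "B \<noteq> 0" "v B = 0"
    using D by (simp_all add: B_def v_divide v_minus)
  have "1 \<in> valuation_ring" "B \<in> valuation_ring" "t \<in> valuation_ring" "N \<in> valuation_ring"
    unfolding N_def using B t valuation_ring_of_nat by (simp_all add: valuation_ring_def v_one)
  then have "1 + B + t * N \<in> valuation_ring"
    by (intro valuation_ring_closed)
  from unit_add_maximal_ideal[OF _ v_one t this]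
  have Aj: "Aj \<noteq> 0" "v Aj = 0"
    by (simp_all add: Aj_def v_minus del: minus_add_distrib)
  have split: "{..m} = insert i (insert j (insert k (insert l R)))"
    using ijkl by (auto simp: R_def)
  have R: "finite R" "i \<notin> R" "j \<notin> R" "k \<notin> R" "l \<notin> R"
    by (auto simp: R_def)
  have AR: "A r = t * t" if "r \<in> R" for r
    using that by (auto simp: A_def R_def)
  have A: "A i = 1" "A j = Aj" "A k = t" "A l = t * B"
    using ne ijkl by (auto simp: A_def)
  have DB: "(of_nat l - of_nat i) * B = - ((of_nat k - of_nat i) + t * (M - of_nat i * N))"
    using D by (simp add: B_def)
  have ji: "(of_nat j :: 'k) = of_nat i"
    using cong by (simp add: of_nat_eq_iff cong_sym_eq)
  have sumR: "(\<Sum>r\<in>R. A r) = t * t * N" "(\<Sum>r\<in>R. of_nat r * A r) = t * t * M"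
    by (simp_all add: AR N_def M_def sum_distrib_left mult.commute cong: sum.cong)
  have sum: "(\<Sum>r\<le>m. A r) = 1 + Aj + t + t * B + t * t * N"
    unfolding split using R ne ijkl by (simp add: A sumR)
  also have "\<dots> = 0"
    by (simp add: Aj_def algebra_simps)
  finally have s0: "(\<Sum>r\<le>m. A r) = 0" .
  have "(\<Sum>r\<le>m. of_nat r * A r)
      = of_nat i + of_nat i * Aj + of_nat k * t + of_nat l * (t * B) + t * t * M"
    unfolding split using R ne ijkl by (simp add: A sumR ji)
  \<comment> \<open>Inserting \<open>Aj\<close> cancels the term \<open>of_nat i\<close>, so that a
    factor \<open>t\<close> splits off.\<close>
  also have "\<dots> = t * ((of_nat l - of_nat i) * B
      + ((of_nat k - of_nat i) + t * (M - of_nat i * N)))"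
    by (simp add: Aj_def algebra_simps)
  also have "\<dots> = 0"
    by (simp add: DB)
  finally have "(\<Sum>r\<le>m. of_nat r * A r) = 0" .
  then have "restrict (\<lambda>r. v (A r)) {..m} \<in> double_root_fan v m"
    using s0 Aj B t by (intro mem_double_root_fanI) (auto simp: A_def)
  then show ?thesis
    using ijkl Aj B t v_one A by (intro bexI exI[of _ "v t"]) (auto simp: A_def v_mult)
qed

end

section \<open>Separation of the cells\<close>

text \<open>The minimum may also be attained outside the set given to
  \<open>min_attained_at\<close>, so only an inclusion results; equality will come from comparing
  cardinalities.\<close>

lemma min_attained_at_subset:
  assumes "min_attained_at a R S'" "s \<in> R" "\<And>r. r \<in> R - S \<Longrightarrow> a s < a r"
  shows "S' \<subseteq> S"
  using assms by (force simp: min_attained_at_def)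

section \<open>Cells and types in terms of index sets\<close>

context valued_field_char
begin

definition triple_cell :: "nat \<Rightarrow> nat set \<Rightarrow> (nat \<Rightarrow> real) set" where
  "triple_cell m S = {a \<in> double_root_fan v m. min_attained_at a {..m} S}"

text \<open>Deleting the residues of all elements of \<open>S\<close> avoids choosing a
  representative; for a congruent pair what is left is the set \<open>remaining\<close>.\<close>

definition pair_cell :: "nat \<Rightarrow> nat set \<times> nat set \<Rightarrow> (nat \<Rightarrow> real) set" where
  "pair_cell m = (\<lambda>(S, U). {a \<in> double_root_fan v m. min_attained_at a {..m} S \<and>
     min_attained_at a {r \<in> {..m}. r mod p \<notin> (\<lambda>r. r mod p) ` S} U})"

definition symmetric_cell :: "nat \<Rightarrow> nat set \<times> nat set \<Rightarrow> (nat \<Rightarrow> real) set" where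
  "symmetric_cell m = (\<lambda>(S, U). pair_cell m (S, U) \<union> pair_cell m (U, S))"

lemma cell_I_eq: "cell_I v m i j k = triple_cell m {i, j, k}"
  by (simp add: cell_I_def triple_cell_def)

lemma cell_II_eq: "[i = j] (mod p) \<Longrightarrow> cell_II v p m i j k l = pair_cell m ({i, j}, {k, l})"
  by (auto simp: cell_II_def pair_cell_def remaining_def cong_def)

lemma cell_III_eq:
  "[i = j] (mod p) \<Longrightarrow> [k = l] (mod p) \<Longrightarrow>
    cell_III v p m i j k l = symmetric_cell m ({i, j}, {k, l})"
  by (simp add: cell_III_def symmetric_cell_def cell_II_eq)

lemma p_pos: "p > 0"
  using prime_p by (simp add: prime_gt_0_nat)

lemma type_I_eq: "type_I v p m = triple_cell m ` indices_I p {..m}"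
proof -
  have "{i, j, k} \<in> indices_I p {..m}"
    if "{i, j, k} \<subseteq> {..m}" "\<not> [i = j] (mod p)" "\<not> [i = k] (mod p)" "\<not> [j = k] (mod p)" for i j k
  proof -
    from that have "i \<noteq> j" "i \<noteq> k" "j \<noteq> k"
      by auto
    with that show ?thesis
      using p_pos by (auto simp: indices_I_def transversals_def cong_def inj_on_def)
  qed
  then have "type_I v p m \<subseteq> triple_cell m ` indices_I p {..m}"
    by (auto simp: type_I_def cell_I_eq)
  moreover have "triple_cell m S \<in> type_I v p m" if S: "S \<in> indices_I p {..m}" for S
  proof -
    from S obtain i j k where "S = {i, j, k}" "i \<noteq> j" "j \<noteq> k" "i \<noteq> k"
      by (auto simp: indices_I_def transversals_def card_3_iff)
    moreover from this S have "{i, j, k} \<subseteq> {..m}" "\<not> [i = j] (mod p)" "\<not> [i = k] (mod p)"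
        "\<not> [j = k] (mod p)"
      by (auto simp: indices_I_def transversals_def inj_on_def cong_def)
    then have "cell_I v m i j k \<in> type_I v p m"
      unfolding type_I_def by blast
    ultimately show ?thesis
      by (simp add: cell_I_eq)
  qed
  ultimately show ?thesis
    by blast
qed

lemma type_II_eq: "type_II v p m = pair_cell m ` indices_II p {..m}"
proof -
  have "({i, j}, {k, l}) \<in> indices_II p {..m}"
    if "{i, j} \<subseteq> {..m}" "{k, l} \<subseteq> remaining p m i" "i \<noteq> j" "[i = j] (mod p)" "\<not> [k = l] (mod p)"
    for i j k l
  proof -
    from that have "k \<noteq> l"
      by auto
    with that show ?thesis
      using p_pos unfolding indices_II_def
      by (intro UN_I[of "i mod p"])
        (auto simp: congruent_pairs_def transversals_def remaining_def cong_def inj_on_def)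
  qed
  then have "type_II v p m \<subseteq> pair_cell m ` indices_II p {..m}"
    by (auto simp: type_II_def cell_II_eq)
  moreover have "pair_cell m (S, U) \<in> type_II v p m" if SU: "(S, U) \<in> indices_II p {..m}" for S U
  proof -
    from SU obtain i j where S: "S = {i, j}" "i \<noteq> j"
      by (auto simp: indices_II_def congruent_pairs_def card_2_iff)
    from SU obtain k l where U: "U = {k, l}" "k \<noteq> l"
      by (auto simp: indices_II_def transversals_def card_2_iff)
    from SU S U have *: "{i, j} \<subseteq> {..m}" "{k, l} \<subseteq> remaining p m i" "[i = j] (mod p)"
        "\<not> [k = l] (mod p)"
      by (auto simp: indices_II_def congruent_pairs_def transversals_def remaining_def
          inj_on_def cong_def)
    then have "cell_II v p m i j k l \<in> type_II v p m"
      unfolding type_II_def using S by blast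
    with S U * show ?thesis
      by (simp add: cell_II_eq)
  qed
  ultimately show ?thesis
    by auto
qed

text \<open>The cell is a union symmetric in the two pairs, so the pair with the smaller residue can
  be put first.\<close>

lemma type_III_eq: "type_III v p m = symmetric_cell m ` indices_III p {..m}"
proof -
  have "cell_III v p m i j k l \<in> symmetric_cell m ` indices_III p {..m}"
    if *: "{i, j} \<subseteq> {..m}" "{k, l} \<subseteq> remaining p m i" "i \<noteq> j" "[i = j] (mod p)"
      "k \<noteq> l" "[k = l] (mod p)" for i j k l
  proof -
    have P: "{i, j} \<in> congruent_pairs p {..m} (i mod p)" "{k, l} \<in> congruent_pairs p {..m} (k mod p)"
      using * by (auto simp: congruent_pairs_def remaining_def cong_def)
    have "i mod p < p" "k mod p < p"
      using p_pos by simp_all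
    moreover have "i mod p \<noteq> k mod p"
      using * by (auto simp: remaining_def cong_def)
    ultimately have "({i, j}, {k, l}) \<in> indices_III p {..m} \<or> ({k, l}, {i, j}) \<in> indices_III p {..m}"
      using P by (meson indices_III_I linorder_neqE_nat)
    moreover have "cell_III v p m i j k l = symmetric_cell m ({i, j}, {k, l})"
      "cell_III v p m i j k l = symmetric_cell m ({k, l}, {i, j})"
      using * by (auto simp: cell_III_eq symmetric_cell_def)
    ultimately show ?thesis
      by blast
  qed
  then have "type_III v p m \<subseteq> symmetric_cell m ` indices_III p {..m}"
    by (auto simp: type_III_def)
  moreover have "symmetric_cell m (S, U) \<in> type_III v p m" if SU: "(S, U) \<in> indices_III p {..m}" for S U
  proof -
    from SU obtain i j where S: "S = {i, j}" "i \<noteq> j"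
      by (auto simp: indices_III_def congruent_pairs_def card_2_iff)
    from SU obtain k l where U: "U = {k, l}" "k \<noteq> l"
      by (auto simp: indices_III_def congruent_pairs_def card_2_iff)
    from SU S U have *: "{i, j} \<subseteq> {..m}" "{k, l} \<subseteq> remaining p m i" "[i = j] (mod p)"
        "[k = l] (mod p)"
      by (auto simp: indices_III_def congruent_pairs_def remaining_def cong_def)
    then have "cell_III v p m i j k l \<in> type_III v p m"
      unfolding type_III_def using S U by blast
    with S U * show ?thesis
      by (simp add: cell_III_eq)
  qed
  ultimately show ?thesis
    by auto
qed

section \<open>Points lying in a single cell\<close>

lemma triple_cell_generic_point:
  assumes S: "S \<in> indices_I p {..m}"
  shows "\<exists>a \<in> triple_cell m S. \<forall>S'. min_attained_at a {..m} S' \<longrightarrow> S' \<subseteq> S"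
proof -
  from S obtain i j k where ijk: "S = {i, j, k}" "i \<noteq> j" "j \<noteq> k" "i \<noteq> k"
    by (auto simp: indices_I_def transversals_def card_3_iff)
  with S have le: "i \<le> m" "j \<le> m" "k \<le> m"
    and "\<not> [i = j] (mod p)" "\<not> [i = k] (mod p)" "\<not> [j = k] (mod p)"
    by (auto simp: indices_I_def transversals_def inj_on_def cong_def)
  from generic_point_triple[OF this] obtain a where a: "a \<in> double_root_fan v m"
      "a i = 0" "a j = 0" "a k = 0" "\<And>r. r \<le> m \<Longrightarrow> r \<notin> S \<Longrightarrow> 0 < a r"
    unfolding ijk by blast
  have "0 \<le> a r" if "r \<le> m" for r
    using a(2-4) a(5)[OF that] by (cases "r \<in> S") (auto simp: ijk)
  then have "a \<in> triple_cell m S"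
    using a le by (auto simp: triple_cell_def min_attained_at_def ijk)
  moreover have "S' \<subseteq> S" if "min_attained_at a {..m} S'" for S'
    by (rule min_attained_at_subset[OF that, of i]) (use a le in auto)
  ultimately show ?thesis
    by blast
qed

text \<open>At the point with values \<open>0\<close> on \<open>S\<close>, \<open>g\<close> on
  \<open>U\<close> and more than \<open>g\<close> elsewhere, \<open>S\<close> consists of all
  minimisers, and \<open>U\<close> of all minimisers left after deleting the class
  \<open>c\<close>.\<close>

lemma pair_cell_generic_point:
  assumes S: "S \<in> congruent_pairs p {..m} c" and U: "U \<subseteq> {..m}" "card U = 2" "\<forall>r\<in>U. r mod p \<noteq> c"
  obtains a where "a \<in> pair_cell m (S, U)" "\<forall>S'. min_attained_at a {..m} S' \<longrightarrow> S' \<subseteq> S"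
    "\<forall>S' U'. card S' = 2 \<longrightarrow> card U' = 2 \<longrightarrow> a \<in> pair_cell m (S', U') \<longrightarrow> S' = S \<and> U' = U"
proof -
  from S obtain i j where ij: "S = {i, j}" "i \<noteq> j"
    by (auto simp: congruent_pairs_def card_2_iff)
  from U obtain k l where kl: "U = {k, l}" "k \<noteq> l"
    by (auto simp: card_2_iff)
  have le: "i \<le> m" "j \<le> m" "k \<le> m" "l \<le> m"
    using S U by (auto simp: ij kl congruent_pairs_def)
  have md: "i mod p = c" "j mod p = c" "k mod p \<noteq> c" "l mod p \<noteq> c"
    using S U by (auto simp: ij kl congruent_pairs_def)
  then have cong: "[i = j] (mod p)" "\<not> [k = i] (mod p)" "\<not> [l = i] (mod p)"
    by (auto simp: cong_def)
  from generic_point_pair[OF le ij(2) kl(2) cong] obtain a g where a: "a \<in> double_root_fan v m"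
      "a i = 0" "a j = 0" "a k = g" "a l = g" "0 < g"
      and others: "\<And>r. r \<le> m \<Longrightarrow> r \<notin> S \<Longrightarrow> r \<notin> U \<Longrightarrow> g < a r"
    unfolding ij kl by blast
  let ?R = "{r \<in> {..m}. r mod p \<notin> (\<lambda>r. r mod p) ` S}"
  have R: "r \<in> ?R \<longleftrightarrow> r \<le> m \<and> r mod p \<noteq> c" for r
    using md by (auto simp: ij)
  have pos: "0 < a r" if "r \<le> m" "r \<notin> S" for r
    using a(4-6) others[OF that] by (cases "r \<in> U") (auto simp: kl)
  have nonneg: "0 \<le> a r" if "r \<le> m" for r
    using a(2,3) pos[OF that] by (cases "r \<in> S") (auto simp: ij)
  have ge: "g \<le> a r" if "r \<in> ?R" for r
  proof -
    from that have "r \<le> m" "r \<notin> S"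
      using md by (auto simp: ij)
    then show ?thesis
      using a(4,5) others[of r] by (cases "r \<in> U") (auto simp: kl)
  qed
  have "min_attained_at a {..m} S"
    using a le nonneg by (auto simp: min_attained_at_def ij)
  moreover have "min_attained_at a ?R U"
    unfolding min_attained_at_def
  proof (intro conjI ballI)
    show "U \<subseteq> ?R"
      using le md by (auto simp: kl ij)
    show "a s \<le> a r" if "s \<in> U" "r \<in> ?R" for s r
      using that(1) ge[OF that(2)] a(4,5) by (auto simp: kl)
  qed
  ultimately have mem: "a \<in> pair_cell m (S, U)"
    using a by (simp add: pair_cell_def)
  have sub: "S' \<subseteq> S" if "min_attained_at a {..m} S'" for S'
    by (rule min_attained_at_subset[OF that, of i]) (use a le pos in auto)
  have uniq: "S' = S \<and> U' = U"
    if "card S' = 2" "card U' = 2" and mem: "a \<in> pair_cell m (S', U')" for S' U'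
  proof -
    have "S' \<subseteq> S"
      using mem by (intro sub) (simp add: pair_cell_def)
    then have eq: "S' = S"
      using that(1) ij by (intro card_subset_eq) auto
    \<comment> \<open>Since \<open>S' = S\<close>, the same class is deleted for both cells, and the
      second pairs can be compared over one range of exponents.\<close>
    have "min_attained_at a ?R U'"
      using mem by (simp add: pair_cell_def eq)
    then have "U' \<subseteq> U"
    proof (rule min_attained_at_subset[of _ _ _ k])
      show "k \<in> ?R"
        using le md by (simp add: ij)
      show "a k < a r" if "r \<in> ?R - U" for r
        using that others[of r] a md by (auto simp: ij)
    qed
    then have "U' = U"
      using that(2) kl by (intro card_subset_eq) auto
    with eq show ?thesis
      by simp
  qed
  show thesis
    using that[of a] mem sub uniq by auto
qed

text \<open>Injectivity of the residue map is the property by which index sets of different types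
  are told apart.\<close>

lemma congruent_pairs_not_inj_on: "S \<in> congruent_pairs p X c \<Longrightarrow> \<not> inj_on (\<lambda>r. r mod p) S"
  by (auto simp: congruent_pairs_def card_2_iff inj_on_def)

lemma indices_II_E:
  assumes "(S, U) \<in> indices_II p {..m}"
  obtains c where "S \<in> congruent_pairs p {..m} c" "U \<subseteq> {..m}" "card S = 2" "card U = 2"
    "\<forall>r\<in>U. r mod p \<noteq> c" "\<not> inj_on (\<lambda>r. r mod p) S" "inj_on (\<lambda>r. r mod p) U"
proof -
  from assms obtain c where
    c: "S \<in> congruent_pairs p {..m} c" "U \<in> transversals p {..m} ({..<p} - {c}) 2"
    by (auto simp: indices_II_def)
  show ?thesis
    by (rule that[of c]) (use c congruent_pairs_not_inj_on[OF c(1)]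
      in \<open>auto simp: congruent_pairs_def transversals_def\<close>)
qed

lemma indices_III_E:
  assumes "(S, U) \<in> indices_III p {..m}"
  obtains c d where "S \<in> congruent_pairs p {..m} c" "U \<in> congruent_pairs p {..m} d" "c < d"
    "card S = 2" "card U = 2" "\<not> inj_on (\<lambda>r. r mod p) S" "\<not> inj_on (\<lambda>r. r mod p) U"
proof -
  from assms obtain c d where
    cd: "S \<in> congruent_pairs p {..m} c" "U \<in> congruent_pairs p {..m} d" "c < d"
    by (auto simp: indices_III_def)
  show ?thesis
    by (rule that[of c d]) (use cd congruent_pairs_not_inj_on[OF cd(1)]
      congruent_pairs_not_inj_on[OF cd(2)] in \<open>auto simp: congruent_pairs_def\<close>)
qed

text \<open>All minimisers of the generic point lie in \<open>S\<close>, where residues are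
  distinct, so no congruent pair fits in; another triple inside \<open>S\<close> equals
  \<open>S\<close> by cardinality.\<close>

lemma triple_cell_separating_point:
  assumes S: "S \<in> indices_I p {..m}"
  shows "\<exists>a \<in> triple_cell m S. (\<forall>S' \<in> indices_I p {..m}. a \<in> triple_cell m S' \<longrightarrow> S' = S) \<and>
    (\<forall>x \<in> indices_II p {..m}. a \<notin> pair_cell m x) \<and>
    (\<forall>x \<in> indices_III p {..m}. a \<notin> symmetric_cell m x)"
proof -
  from triple_cell_generic_point[OF S] obtain a where
    a: "a \<in> triple_cell m S" "\<And>S'. min_attained_at a {..m} S' \<Longrightarrow> S' \<subseteq> S"
    by blast
  have S3: "card S = 3" "finite S" "inj_on (\<lambda>r. r mod p) S"
    using S by (auto simp: indices_I_def transversals_def card_ge_0_finite)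
  have "S' = S" if "S' \<in> indices_I p {..m}" "a \<in> triple_cell m S'" for S'
    using that S3 a(2)[of S']
    by (intro card_subset_eq) (auto simp: indices_I_def transversals_def triple_cell_def)
  moreover have pair: "a \<notin> pair_cell m (S', U')" if "\<not> inj_on (\<lambda>r. r mod p) S'" for S' U'
    using that a(2)[of S'] S3(3) by (auto simp: pair_cell_def dest: inj_on_subset)
  moreover have "a \<notin> symmetric_cell m (S', U')" if "(S', U') \<in> indices_III p {..m}" for S' U'
    using that by (elim indices_III_E) (auto simp: symmetric_cell_def pair)
  ultimately show ?thesis
    using a(1) by (intro bexI[of _ a]) (auto elim!: indices_II_E)
qed

text \<open>A triple does not fit into the two minimisers in \<open>S\<close>. A cell of type III
  through the point would have \<open>U\<close> as one of its pairs, but \<open>U\<close> has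
  distinct residues.\<close>

lemma pair_cell_separating_point:
  assumes SU: "(S, U) \<in> indices_II p {..m}"
  shows "\<exists>a \<in> pair_cell m (S, U). (\<forall>S' \<in> indices_I p {..m}. a \<notin> triple_cell m S') \<and>
    (\<forall>x \<in> indices_II p {..m}. a \<in> pair_cell m x \<longrightarrow> x = (S, U)) \<and>
    (\<forall>x \<in> indices_III p {..m}. a \<notin> symmetric_cell m x)"
proof -
  from SU obtain c where c: "S \<in> congruent_pairs p {..m} c" "U \<subseteq> {..m}" "card S = 2" "card U = 2"
    "\<forall>r\<in>U. r mod p \<noteq> c" "\<not> inj_on (\<lambda>r. r mod p) S" "inj_on (\<lambda>r. r mod p) U"
    by (rule indices_II_E)
  obtain a where a: "a \<in> pair_cell m (S, U)" "\<forall>S'. min_attained_at a {..m} S' \<longrightarrow> S' \<subseteq> S"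
    "\<forall>S' U'. card S' = 2 \<longrightarrow> card U' = 2 \<longrightarrow> a \<in> pair_cell m (S', U') \<longrightarrow> S' = S \<and> U' = U"
    by (rule pair_cell_generic_point[OF c(1,2,4,5)])
  have "finite S"
    using c(3) by (simp add: card_ge_0_finite)
  have "a \<notin> triple_cell m S'" if "S' \<in> indices_I p {..m}" for S'
    using that a(2)[rule_format, of S'] c(3) card_mono[OF \<open>finite S\<close>, of S']
    by (auto simp: triple_cell_def indices_I_def transversals_def)
  moreover have "x = (S, U)" if "x \<in> indices_II p {..m}" "a \<in> pair_cell m x" for x
    using that a(3)[rule_format, of "fst x" "snd x"] by (cases x) (auto elim!: indices_II_E)
  moreover have "a \<notin> symmetric_cell m (S', U')" if x: "(S', U') \<in> indices_III p {..m}" for S' U'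
  proof
    assume "a \<in> symmetric_cell m (S', U')"
    with x a(3)[rule_format, of S' U'] a(3)[rule_format, of U' S'] c(7) show False
      by (elim indices_III_E) (auto simp: symmetric_cell_def)
  qed
  ultimately show ?thesis
    using a(1) by (intro bexI[of _ a]) auto
qed

text \<open>A generic point of one half of the cell suffices. A second index of type III could only
  be the swapped pair, which the order of the residues excludes.\<close>

lemma symmetric_cell_separating_point:
  assumes SU: "(S, U) \<in> indices_III p {..m}"
  shows "\<exists>a \<in> symmetric_cell m (S, U). (\<forall>S' \<in> indices_I p {..m}. a \<notin> triple_cell m S') \<and>
    (\<forall>x \<in> indices_II p {..m}. a \<notin> pair_cell m x) \<and>
    (\<forall>x \<in> indices_III p {..m}. a \<in> symmetric_cell m x \<longrightarrow> x = (S, U))"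
proof -
  from SU obtain c d where cd: "S \<in> congruent_pairs p {..m} c" "U \<in> congruent_pairs p {..m} d" "c < d"
    "card S = 2" "card U = 2" "\<not> inj_on (\<lambda>r. r mod p) S" "\<not> inj_on (\<lambda>r. r mod p) U"
    by (rule indices_III_E)
  have U: "U \<subseteq> {..m}" "\<forall>r\<in>U. r mod p \<noteq> c"
    using cd by (auto simp: congruent_pairs_def)
  obtain a where
    a: "a \<in> pair_cell m (S, U)" "\<forall>S'. min_attained_at a {..m} S' \<longrightarrow> S' \<subseteq> S"
    "\<forall>S' U'. card S' = 2 \<longrightarrow> card U' = 2 \<longrightarrow> a \<in> pair_cell m (S', U') \<longrightarrow> S' = S \<and> U' = U"
    by (rule pair_cell_generic_point[OF cd(1) U(1) cd(5) U(2)])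
  have "finite S"
    using cd(4) by (simp add: card_ge_0_finite)
  have "a \<notin> triple_cell m S'" if "S' \<in> indices_I p {..m}" for S'
    using that a(2)[rule_format, of S'] cd(4) card_mono[OF \<open>finite S\<close>, of S']
    by (auto simp: triple_cell_def indices_I_def transversals_def)
  moreover have "a \<notin> pair_cell m (S', U')" if x: "(S', U') \<in> indices_II p {..m}" for S' U'
  proof
    assume "a \<in> pair_cell m (S', U')"
    with x a(3)[rule_format, of S' U'] cd(7) show False
      by (elim indices_II_E) auto
  qed
  moreover have "S' = S \<and> U' = U"
    if x: "(S', U') \<in> indices_III p {..m}" and mem: "a \<in> symmetric_cell m (S', U')" for S' U'
  proof -
    from x obtain c' d' where cd': "S' \<in> congruent_pairs p {..m} c'" "U' \<in> congruent_pairs p {..m} d'"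
      "c' < d'" "card S' = 2" "card U' = 2"
      by (rule indices_III_E)
    have False if "S' = U" "U' = S"
    proof -
      have "c' = d" "d' = c"
        using cd cd' that by (auto dest: congruent_pairs_unique)
      with cd cd' show False
        by simp
    qed
    moreover have "a \<in> pair_cell m (S', U') \<or> a \<in> pair_cell m (U', S')"
      using mem by (simp add: symmetric_cell_def)
    then have "S' = S \<and> U' = U \<or> U' = S \<and> S' = U"
      using a(3) cd'(4,5) by blast
    ultimately show ?thesis
      by blast
  qed
  ultimately show ?thesis
    using a(1) by (intro bexI[of _ a]) (auto simp: symmetric_cell_def)
qed

section \<open>Maximality of the cells and injectivity of the indexing\<close>

text \<open>A cell containing \<open>C\<close> contains the separating point of \<open>C\<close>,
  and \<open>C\<close> is the only cell through that point.\<close>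

lemma facets_eq: "facets v p m = type_I v p m \<union> type_II v p m \<union> type_III v p m"
proof -
  have "C = D" if C: "C \<in> type_I v p m \<union> type_II v p m \<union> type_III v p m"
    and D: "D \<in> type_I v p m \<union> type_II v p m \<union> type_III v p m" "C \<subseteq> D" for C D
  proof -
    consider S where "S \<in> indices_I p {..m}" "C = triple_cell m S"
      | S U where "(S, U) \<in> indices_II p {..m}" "C = pair_cell m (S, U)"
      | S U where "(S, U) \<in> indices_III p {..m}" "C = symmetric_cell m (S, U)"
      using C unfolding type_I_eq type_II_eq type_III_eq
      by (elim UnE imageE) (metis surj_pair)+
    \<comment> \<open>The three cases share this form: for cells of a type other than that of
      \<open>C\<close> the implication is vacuous.\<close>
    then obtain a where "a \<in> C"
      "\<forall>S' \<in> indices_I p {..m}. a \<in> triple_cell m S' \<longrightarrow> triple_cell m S' = C"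
      "\<forall>x \<in> indices_II p {..m}. a \<in> pair_cell m x \<longrightarrow> pair_cell m x = C"
      "\<forall>x \<in> indices_III p {..m}. a \<in> symmetric_cell m x \<longrightarrow> symmetric_cell m x = C"
    proof cases
      case 1
      from triple_cell_separating_point[OF 1(1)] obtain a where a: "a \<in> C"
        "\<forall>S' \<in> indices_I p {..m}. a \<in> triple_cell m S' \<longrightarrow> triple_cell m S' = C"
        "\<forall>x \<in> indices_II p {..m}. a \<in> pair_cell m x \<longrightarrow> pair_cell m x = C"
        "\<forall>x \<in> indices_III p {..m}. a \<in> symmetric_cell m x \<longrightarrow> symmetric_cell m x = C"
        unfolding 1(2) by metis
      show ?thesis
        by (rule that) (fact a)+
    next
      case 2
      from pair_cell_separating_point[OF 2(1)] obtain a where a: "a \<in> C"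
        "\<forall>S' \<in> indices_I p {..m}. a \<in> triple_cell m S' \<longrightarrow> triple_cell m S' = C"
        "\<forall>x \<in> indices_II p {..m}. a \<in> pair_cell m x \<longrightarrow> pair_cell m x = C"
        "\<forall>x \<in> indices_III p {..m}. a \<in> symmetric_cell m x \<longrightarrow> symmetric_cell m x = C"
        unfolding 2(2) by metis
      show ?thesis
        by (rule that) (fact a)+
    next
      case 3
      from symmetric_cell_separating_point[OF 3(1)] obtain a where a: "a \<in> C"
        "\<forall>S' \<in> indices_I p {..m}. a \<in> triple_cell m S' \<longrightarrow> triple_cell m S' = C"
        "\<forall>x \<in> indices_II p {..m}. a \<in> pair_cell m x \<longrightarrow> pair_cell m x = C"
        "\<forall>x \<in> indices_III p {..m}. a \<in> symmetric_cell m x \<longrightarrow> symmetric_cell m x = C"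
        unfolding 3(2) by metis
      show ?thesis
        by (rule that) (fact a)+
    qed
    with D show ?thesis
      unfolding type_I_eq type_II_eq type_III_eq by blast
  qed
  then show ?thesis
    unfolding facets_def by blast
qed

text \<open>Equal cells share a separating point, and this point determines the index; the same
  argument serves the other two types.\<close>

lemma card_type_I: "card (type_I v p m) = card (indices_I p {..m})"
proof -
  have "inj_on (triple_cell m) (indices_I p {..m})"
    using triple_cell_separating_point by (intro inj_onI) metis
  then show ?thesis
    by (simp add: type_I_eq card_image)
qed

lemma card_type_II: "card (type_II v p m) = card (indices_II p {..m})"
proof -
  have "inj_on (pair_cell m) (indices_II p {..m})"
    using pair_cell_separating_point by (intro inj_onI) (metis surj_pair)
  then show ?thesis
    by (simp add: type_II_eq card_image)
qed

lemma card_type_III: "card (type_III v p m) = card (indices_III p {..m})"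
proof -
  have "inj_on (symmetric_cell m) (indices_III p {..m})"
    using symmetric_cell_separating_point by (intro inj_onI) (metis surj_pair)
  then show ?thesis
    by (simp add: type_III_eq card_image)
qed

end

section \<open>The number of facets\<close>

lemma card_type_I_le: "card (type_I v p m) \<le> Suc m ^ 3"
proof -
  have "type_I v p m \<subseteq> (\<lambda>(i, j, k). cell_I v m i j k) ` ({..m} \<times> {..m} \<times> {..m})"
    by (force simp: type_I_def)
  from surj_card_le[OF _ this] show ?thesis
    by (simp add: card_cartesian_product power_numeral_reduce)
qed

lemma card_type_II_le: "card (type_II v p m) \<le> Suc m ^ 4"
proof -
  have "type_II v p m \<subseteq>
      (\<lambda>(i, j, k, l). cell_II v p m i j k l) ` ({..m} \<times> {..m} \<times> {..m} \<times> {..m})"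
    by (force simp: type_II_def remaining_def)
  from surj_card_le[OF _ this] show ?thesis
    by (simp add: card_cartesian_product power_numeral_reduce)
qed

lemma card_type_III_le: "card (type_III v p m) \<le> Suc m ^ 4"
proof -
  have "type_III v p m \<subseteq>
      (\<lambda>(i, j, k, l). cell_III v p m i j k l) ` ({..m} \<times> {..m} \<times> {..m} \<times> {..m})"
    by (force simp: type_III_def remaining_def)
  from surj_card_le[OF _ this] show ?thesis
    by (simp add: card_cartesian_product power_numeral_reduce)
qed

text \<open>Counting all tuples of exponents up to \<open>m\<close> bounds the facets for every
  \<open>m\<close>, not just for those of the form \<open>p * n - 1\<close>. The constant is
  \<open>48 = 3 * 2 ^ 4\<close>, from three types and \<open>Suc m \<le> 2 * m\<close> for
  \<open>m \<ge> 1\<close>.\<close>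

lemma card_facets_bigo: "(\<lambda>m. real (card (facets v p m))) \<in> O(\<lambda>m. real m ^ 4)"
proof (rule bigoI[of _ 48])
  have "card (facets v p m) \<le> 48 * m ^ 4" if "m \<ge> 1" for m
  proof -
    let ?T = "type_I v p m \<union> type_II v p m \<union> type_III v p m"
    have "finite ?T"
    proof -
      have "?T \<subseteq> (\<lambda>(i, j, k). cell_I v m i j k) ` ({..m} \<times> {..m} \<times> {..m})
        \<union> (\<lambda>(i, j, k, l). cell_II v p m i j k l) ` ({..m} \<times> {..m} \<times> {..m} \<times> {..m})
        \<union> (\<lambda>(i, j, k, l). cell_III v p m i j k l) ` ({..m} \<times> {..m} \<times> {..m} \<times> {..m})"
        by (force simp: type_I_def type_II_def type_III_def remaining_def)
      then show ?thesis
        by (rule finite_subset) simp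
    qed
    then have "card (facets v p m) \<le> card ?T"
      by (rule card_mono) (auto simp: facets_def)
    also have "\<dots> \<le> card (type_I v p m) + card (type_II v p m) + card (type_III v p m)"
      by (meson card_Un_le add_le_mono1 order_trans)
    also have "\<dots> \<le> Suc m ^ 3 + Suc m ^ 4 + Suc m ^ 4"
      by (intro add_mono card_type_I_le card_type_II_le card_type_III_le)
    also have "\<dots> \<le> 3 * Suc m ^ 4"
      using power_increasing[of 3 4 "Suc m"] by simp
    also have "\<dots> \<le> 3 * (2 * m) ^ 4"
      using that by (intro mult_le_mono2 power_mono) auto
    finally show ?thesis
      by (simp add: power_mult_distrib)
  qed
  then have "real (card (facets v p m)) \<le> real (48 * m ^ 4)" if "m \<ge> 1" for m
    using that by (intro of_nat_mono)
  then show "\<forall>\<^sub>F m in sequentially. norm (real (card (facets v p m))) \<le> 48 * norm (real m ^ 4)"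
    by (intro eventually_sequentiallyI[of 1]) simp
qed

theorem mainTheorem7:
  fixes v :: "'k::alg_closed_field \<Rightarrow> real" and T :: "real set" and p :: nat
  assumes "valuation_on v T" and "\<rat> \<subseteq> T" and "nontrivial_valuation v"
    and "prime p" and "p > 2"
    and "CHAR('k) = p" and "residue_char v = p"
  shows "(\<forall>n\<ge>1.
            card (facets v p (p * n - 1) \<inter> type_I v p (p * n - 1)) = (p choose 3) * n ^ 3 \<and>
            card (facets v p (p * n - 1) \<inter> type_II v p (p * n - 1))
              = p * n ^ 2 * (n choose 2) * ((p - 1) choose 2) \<and>
            card (facets v p (p * n - 1) \<inter> type_III v p (p * n - 1))
              = (p choose 2) * (n choose 2) ^ 2) \<and>
         (\<lambda>m. real (card (facets v p m))) \<in> O(\<lambda>m. real m ^ 4)"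
proof (intro conjI allI impI card_facets_bigo)
  interpret valued_field_char v T p
    using assms by unfold_locales auto
  fix n :: nat assume "n \<ge> 1"
  \<comment> \<open>As \<open>p * n\<close> is positive, the subtraction is not truncated, and the
    exponents fill each residue class with exactly \<open>n\<close> elements.\<close>
  then have "{..p * n - 1} = {..<p * n}"
    using p_pos by (cases "p * n") (auto simp: lessThan_Suc_atMost)
  moreover have "facets v p m \<inter> type_I v p m = type_I v p m"
      "facets v p m \<inter> type_II v p m = type_II v p m"
      "facets v p m \<inter> type_III v p m = type_III v p m" for m
    by (auto simp: facets_eq)
  ultimately show
    "card (facets v p (p * n - 1) \<inter> type_I v p (p * n - 1)) = (p choose 3) * n ^ 3"
    "card (facets v p (p * n - 1) \<inter> type_II v p (p * n - 1))
       = p * n ^ 2 * (n choose 2) * ((p - 1) choose 2)"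
    "card (facets v p (p * n - 1) \<inter> type_III v p (p * n - 1)) = (p choose 2) * (n choose 2) ^ 2"
    by (simp_all only: card_type_I card_type_II card_type_III
        card_indices_I card_indices_II card_indices_III)
qed

end
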